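(* Let $\lambda>0$ and $\rho>0$ be fixed and, for $\alpha>0$, let $$\varphi_{\alpha\delta,\rho}(x)=\Big(\frac{\sqrt\lambda\,\rho}{2\sqrt2}+\frac{\alpha}{\sqrt{2\lambda}}\Big)\operatorname{sech}\Big(\Big(\frac{\lambda\rho}4+\frac\alpha2\Big)(|x|-\bar x_{\alpha,\rho,\lambda})\Big),\qquad \bar x_{\alpha,\rho,\lambda}=\frac{2}{\lambda\rho+2\alpha}\log\frac{\lambda\rho}{\lambda\rho+4\alpha}.$$ Then $$\varphi_{\alpha\delta,\rho}\longrightarrow\phi\Big(\frac{\sqrt\lambda\,\rho}{2\sqrt2},\frac{\lambda\rho}4,0\Big)\quad\text{in }H^1(\mathbb R),\qquad\text{as }\alpha\to0+.$$
   Context: For $A,B>0$, $C\in\mathbb R$, $\phi(A,B,C)$ denotes the function $x\mapsto\phi(A,B,C;x)=A\operatorname{sech}(Bx-C)$. The function $\varphi_{\alpha\delta,\rho}$ is the stationary state (ground state) of squared $L^2$-norm $\rho$ of the cubic focusing nonlinear Schrödinger equation with nonlinearity coefficient $\lambda$ and attractive Dirac delta potential $-\alpha\delta_0$ on the line. *)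

theory Defs
  imports "HOL-Analysis.Analysis"
begin

section \<open>The Sobolev space of order one on the real line\<close>

definition test_function :: "(real \<Rightarrow> real) \<Rightarrow> bool" where
  "test_function \<psi> \<longleftrightarrow>
     (\<forall>n. ((deriv ^^ n) \<psi>) differentiable_on UNIV) \<and> compact (closure {x. \<psi> x \<noteq> 0})"

definition locally_integrable :: "(real \<Rightarrow> 'a::euclidean_space) \<Rightarrow> bool" where
  "locally_integrable f \<longleftrightarrow> (\<forall>K. compact K \<longrightarrow> set_integrable lborel K f)"

text \<open>Real test functions suffice for values in \<open>'a\<close> (e.g. \<open>real\<close> or \<open>complex\<close>).\<close>

definition has_weak_deriv :: "(real \<Rightarrow> 'a::euclidean_space) \<Rightarrow> (real \<Rightarrow> 'a) \<Rightarrow> bool" where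
  "has_weak_deriv f g \<longleftrightarrow> locally_integrable f \<and> locally_integrable g \<and>
     (\<forall>\<psi>. test_function \<psi> \<longrightarrow>
        (LINT x|lborel. deriv \<psi> x *\<^sub>R f x) = - (LINT x|lborel. \<psi> x *\<^sub>R g x))"

text \<open>Elements of \<open>L2\<close> and \<open>H1\<close> are functions rather than classes modulo equality almost everywhere;
  Borel representatives are used.\<close>

definition L2 :: "(real \<Rightarrow> 'a::euclidean_space) set" where
  "L2 = {f. f \<in> borel_measurable lborel \<and> integrable lborel (\<lambda>x. (norm (f x))\<^sup>2)}"

definition H1 :: "(real \<Rightarrow> 'a::euclidean_space) set" where
  "H1 = {f \<in> L2. \<exists>g \<in> L2. has_weak_deriv f g}"

text \<open>A weak derivative is unique up to a null set, so the choice does not affect the integral in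
  the norm below. Off \<open>H1\<close> the values of \<open>weak_deriv\<close> and \<open>H1_norm\<close> are meaningless.\<close>

definition weak_deriv :: "(real \<Rightarrow> 'a::euclidean_space) \<Rightarrow> real \<Rightarrow> 'a" where
  "weak_deriv f = (SOME g. g \<in> L2 \<and> has_weak_deriv f g)"

definition H1_norm :: "(real \<Rightarrow> 'a::euclidean_space) \<Rightarrow> real" where
  "H1_norm f = sqrt ((LINT x|lborel. (norm (f x))\<^sup>2) + (LINT x|lborel. (norm (weak_deriv f x))\<^sup>2))"

definition tendsto_H1 ::
    "('i \<Rightarrow> real \<Rightarrow> 'a::euclidean_space) \<Rightarrow> (real \<Rightarrow> 'a) \<Rightarrow> 'i filter \<Rightarrow> bool" where
  "tendsto_H1 f l F \<longleftrightarrow> eventually (\<lambda>i. f i \<in> H1) F \<and> l \<in> H1 \<and>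
     ((\<lambda>i. H1_norm (\<lambda>x. f i x - l x)) \<longlongrightarrow> 0) F"


section \<open>Soliton and delta ground state\<close>

definition sech :: "real \<Rightarrow> real" where
  "sech x = 1 / cosh x"

definition soliton :: "real \<Rightarrow> real \<Rightarrow> real \<Rightarrow> real \<Rightarrow> real" where
  "soliton A B C x = A * sech (B * x - C)"

definition delta_shift :: "real \<Rightarrow> real \<Rightarrow> real \<Rightarrow> real" where
  "delta_shift \<alpha> \<rho> lam = 2 / (lam * \<rho> + 2 * \<alpha>) * ln (lam * \<rho> / (lam * \<rho> + 4 * \<alpha>))"

definition delta_ground_state :: "real \<Rightarrow> real \<Rightarrow> real \<Rightarrow> real \<Rightarrow> real" where
  "delta_ground_state \<alpha> \<rho> lam x =
     (sqrt lam * \<rho> / (2 * sqrt 2) + \<alpha> / sqrt (2 * lam)) *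
     sech ((lam * \<rho> / 4 + \<alpha> / 2) * (\<bar>x\<bar> - delta_shift \<alpha> \<rho> lam))"

end

theory Submission
  imports Defs
begin

text \<open>
  Both the ground state and the limiting soliton are profiles \<open>A sech (B (\<bar>x\<bar> - s))\<close>; for the
  soliton \<open>s = 0\<close>, and the absolute value disappears because \<open>sech\<close> is even. As \<open>\<alpha>\<close> tends to zero,
  the amplitude, the width parameter and the shift converge to those of the soliton, so the profiles
  and their classical derivatives, which exist away from the cusp at the origin, converge pointwise
  there. For \<open>\<alpha> > 0\<close> the shift is negative and \<open>B\<close> is at least \<open>b = lam \<rho> / 4\<close>, hence
  \<open>\<bar>B (\<bar>x\<bar> - s)\<bar> \<ge> \<bar>b x\<bar>\<close>: along every sequence decreasing to zero all profiles and derivatives lie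
  below one multiple of \<open>sech (b x)\<close>, whose square is integrable with antiderivative
  \<open>tanh (b x) / b\<close>. Dominated convergence then makes the squared differences of profiles and of
  derivatives tend to zero in mean (\<open>sech_cusp_tendsto_H1_norm\<close>).

  What connects this computation with the Sobolev norm is that the classical derivative of a
  continuous, piecewise differentiable function is a weak derivative
  (\<open>has_weak_deriv_if_piecewise_DERIV\<close>). The norm, however, is defined through an arbitrarily chosen
  weak derivative, so it can be evaluated with the classical one only because weak derivatives are
  unique almost everywhere (\<open>weak_deriv_unique_AE\<close>). This uniqueness is the fundamental lemma of the
  calculus of variations. It rests on explicit smooth bump functions, built from \<open>exp (- (1 / x))\<close>,
  that converge boundedly to the indicator function of an open interval.
\<close>

section \<open>Smooth bump functions\<close>

text \<open>The powers in the denominator make the family closed, up to linear combinations, under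
  differentiation.\<close>

definition flat_exp :: "nat \<Rightarrow> real \<Rightarrow> real" where
  "flat_exp k x = (if x > 0 then exp (- (1 / x)) / x ^ k else 0)"

lemma flat_exp_tendsto_0: "(flat_exp k \<longlongrightarrow> 0) (at 0)"
proof (rule filterlim_split_at)
  have "eventually (\<lambda>x::real. 0 = flat_exp k x) (at_left 0)"
    by (auto simp: flat_exp_def eventually_at_filter)
  then show "(flat_exp k \<longlongrightarrow> 0) (at_left 0)"
    by (rule Lim_transform_eventually[OF tendsto_const])
  have "((\<lambda>x::real. (inverse x) ^ k / exp (inverse x)) \<longlongrightarrow> 0) (at_right 0)"
    by (rule filterlim_compose[OF tendsto_power_div_exp_0 filterlim_inverse_at_top_right])
  moreover have "eventually (\<lambda>x::real. (inverse x) ^ k / exp (inverse x) = flat_exp k x) (at_right 0)"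
    by (auto simp: flat_exp_def eventually_at_filter exp_minus field_simps)
  ultimately show "(flat_exp k \<longlongrightarrow> 0) (at_right 0)"
    by (rule Lim_transform_eventually)
qed

text \<open>At the origin the difference quotient of \<open>flat_exp k\<close> is \<open>flat_exp (k + 1)\<close>, which tends to
  zero because the exponential beats every power.\<close>

lemma DERIV_flat_exp:
  "(flat_exp k has_real_derivative flat_exp (k + 2) x - real k * flat_exp (k + 1) x) (at x)"
proof -
  consider "x > 0" | "x < 0" | "x = 0" by linarith
  then show ?thesis
  proof cases
    case 1
    have "((\<lambda>x. exp (- (1 / x)) / x ^ k) has_real_derivative
        flat_exp (k + 2) x - real k * flat_exp (k + 1) x) (at x)"
    proof (cases k)
      case 0
      then show ?thesis using 1
        by (auto intro!: derivative_eq_intros simp: flat_exp_def power2_eq_square field_simps)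
    next
      case (Suc m)
      then show ?thesis using 1
        by (auto intro!: derivative_eq_intros simp: flat_exp_def power2_eq_square field_simps)
           (cases m; simp)
    qed
    then show ?thesis
      by (rule DERIV_cong_ev[THEN iffD1, rotated -1, OF _ refl _ refl])
         (use 1 in \<open>auto simp: flat_exp_def eventually_nhds intro!: exI[of _ "{0<..}"]\<close>)
  next
    case 2
    have "((\<lambda>x. 0) has_real_derivative 0) (at x)" by simp
    then have "(flat_exp k has_real_derivative 0) (at x)"
      by (rule DERIV_cong_ev[THEN iffD1, rotated -1, OF _ refl _ refl])
         (use 2 in \<open>auto simp: flat_exp_def eventually_nhds intro!: exI[of _ "{..<0}"]\<close>)
    with 2 show ?thesis by (simp add: flat_exp_def)
  next
    case 3
    have "(\<lambda>h. (flat_exp k (0 + h) - flat_exp k 0) / h) = flat_exp (k + 1)"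
      by (auto simp: flat_exp_def fun_eq_iff)
    then have "(flat_exp k has_real_derivative 0) (at 0)"
      unfolding DERIV_def using flat_exp_tendsto_0[of "k + 1"] by simp
    with 3 show ?thesis by (simp add: flat_exp_def)
  qed
qed

text \<open>Smoothness needs no formula for higher derivatives, only a family of functions that contains the
  bump functions and is closed under differentiation. By the product rule, the linear span of these
  products is such a family.\<close>

inductive_set bump_span :: "real \<Rightarrow> real \<Rightarrow> real \<Rightarrow> (real \<Rightarrow> real) set" for c a b where
  prod: "(\<lambda>x. flat_exp k (c * (x - a)) * flat_exp l (c * (b - x))) \<in> bump_span c a b"
| add: "f \<in> bump_span c a b \<Longrightarrow> g \<in> bump_span c a b \<Longrightarrow> (\<lambda>x. f x + g x) \<in> bump_span c a b"
| scale: "f \<in> bump_span c a b \<Longrightarrow> (\<lambda>x. r * f x) \<in> bump_span c a b"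

lemma bump_span_DERIV:
  assumes "f \<in> bump_span c a b"
  shows "\<exists>f' \<in> bump_span c a b. \<forall>x. (f has_real_derivative f' x) (at x)"
  using assms
proof induction
  case (prod k l)
  let ?F = "\<lambda>k l x. flat_exp k (c * (x - a)) * flat_exp l (c * (b - x))"
  let ?D = "\<lambda>x. (c * ?F (k + 2) l x + (- c * real k) * ?F (k + 1) l x)
          + ((- c) * ?F k (l + 2) x + (c * real l) * ?F k (l + 1) x)"
  have "(?F k l has_real_derivative ?D x) (at x)" for x
  proof -
    have 1: "((\<lambda>x. flat_exp k (c * (x - a))) has_real_derivative
        (flat_exp (k + 2) (c * (x - a)) - real k * flat_exp (k + 1) (c * (x - a))) * c) (at x)"
      by (rule DERIV_chain2[OF DERIV_flat_exp]) (auto intro!: derivative_eq_intros)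
    have 2: "((\<lambda>x. flat_exp l (c * (b - x))) has_real_derivative
        (flat_exp (l + 2) (c * (b - x)) - real l * flat_exp (l + 1) (c * (b - x))) * (- c)) (at x)"
      by (rule DERIV_chain2[OF DERIV_flat_exp]) (auto intro!: derivative_eq_intros)
    show ?thesis
      using DERIV_mult[OF 1 2] by (rule back_subst[of "\<lambda>d. DERIV _ _ :> d"]) (simp add: algebra_simps)
  qed
  moreover have "?D \<in> bump_span c a b"
    by (rule bump_span.add bump_span.scale bump_span.prod)+
  ultimately show ?case by (intro bexI[of _ ?D]) blast+
next
  case (add f g)
  then obtain f' g' where "f' \<in> bump_span c a b" "\<forall>x. (f has_real_derivative f' x) (at x)"
     "g' \<in> bump_span c a b" "\<forall>x. (g has_real_derivative g' x) (at x)" by blast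
  then show ?case
    by (intro bexI[of _ "\<lambda>x. f' x + g' x"]) (auto intro!: bump_span.intros DERIV_add)
next
  case (scale f r)
  then obtain f' where "f' \<in> bump_span c a b" "\<forall>x. (f has_real_derivative f' x) (at x)" by blast
  then show ?case
    by (intro bexI[of _ "\<lambda>x. r * f' x"]) (auto intro!: bump_span.intros DERIV_cmult)
qed

lemma bump_span_iterated_deriv:
  assumes "f \<in> bump_span c a b"
  shows "(deriv ^^ n) f \<in> bump_span c a b"
proof (induction n)
  case (Suc n)
  then obtain f' where f': "f' \<in> bump_span c a b"
      "\<And>x. ((deriv ^^ n) f has_real_derivative f' x) (at x)"
    using bump_span_DERIV by blast
  then have "deriv ((deriv ^^ n) f) = f'"
    by (auto simp: DERIV_imp_deriv)
  with f' show ?case by simp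
qed (use assms in simp)

definition bump :: "real \<Rightarrow> real \<Rightarrow> real \<Rightarrow> real \<Rightarrow> real" where
  "bump c a b x = flat_exp 0 (c * (x - a)) * flat_exp 0 (c * (b - x))"

lemma bump_eq_0: "c > 0 \<Longrightarrow> x \<notin> {a<..<b} \<Longrightarrow> bump c a b x = 0"
  by (auto simp: bump_def flat_exp_def zero_less_mult_iff)

lemma bump_bounds: "bump c a b x \<in> {0..1}"
proof -
  have "flat_exp 0 y \<in> {0..1}" for y by (auto simp: flat_exp_def)
  then show ?thesis by (auto simp: bump_def intro: mult_le_one)
qed

lemma test_function_bump:
  assumes "c > 0"
  shows "test_function (bump c a b)"
proof -
  have "bump c a b \<in> bump_span c a b"
    using bump_span.prod[of 0 c a 0 b] by (simp add: bump_def[abs_def])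
  then have "\<exists>f'. \<forall>x. ((deriv ^^ n) (bump c a b) has_real_derivative f' x) (at x)" for n
    using bump_span_DERIV[OF bump_span_iterated_deriv] by blast
  then have "((deriv ^^ n) (bump c a b)) differentiable_on UNIV" for n
    by (meson differentiable_at_imp_differentiable_on real_differentiable_def)
  moreover have "bounded {x. bump c a b x \<noteq> 0}"
    by (rule bounded_subset[of "{a<..<b}"]) (simp, use bump_eq_0[OF assms] in blast)
  ultimately show ?thesis
    by (simp add: test_function_def)
qed

text \<open>Inside the interval both factors are \<open>exp (- (1 / (n d)))\<close> with \<open>d > 0\<close>, so they tend to one
  as \<open>n\<close> grows.\<close>

lemma bump_tendsto_indicator:
  "(\<lambda>n. bump (real (Suc n)) a b x) \<longlonglongrightarrow> indicator {a<..<b} x"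
proof (cases "x \<in> {a<..<b}")
  case True
  have *: "(\<lambda>n. flat_exp 0 (real (Suc n) * d)) \<longlonglongrightarrow> 1" if "d > 0" for d :: real
  proof -
    have "(\<lambda>n. exp (- (inverse (real (Suc n)) / d))) \<longlonglongrightarrow> exp (- (0 / d))"
      using that by (intro tendsto_intros LIMSEQ_inverse_real_of_nat) auto
    then show ?thesis using that by (simp add: flat_exp_def divide_simps)
  qed
  show ?thesis
    unfolding bump_def using tendsto_mult[OF *[of "x - a"] *[of "b - x"]] True by simp
next
  case False
  then show ?thesis using bump_eq_0[of "real (Suc _)" x a b] by simp
qed

section \<open>Uniqueness of weak derivatives\<close>

lemma test_function_DERIV:
  assumes "test_function \<psi>"
  shows "(\<psi> has_real_derivative deriv \<psi> x) (at x)"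
proof -
  have "(deriv ^^ 0) \<psi> differentiable_on UNIV"
    using assms unfolding test_function_def by blast
  then show ?thesis
    by (simp add: differentiable_on_def DERIV_deriv_iff_real_differentiable)
qed

lemma test_function_continuous_deriv:
  assumes "test_function \<psi>"
  shows "continuous_on A (deriv \<psi>)"
proof -
  have "(deriv ^^ 1) \<psi> differentiable_on UNIV"
    using assms unfolding test_function_def by blast
  then show ?thesis
    using differentiable_imp_continuous_on continuous_on_subset by fastforce
qed

lemma test_function_continuous:
  assumes "test_function \<psi>"
  shows "continuous_on A \<psi>"
  using test_function_DERIV[OF assms] by (meson DERIV_isCont continuous_at_imp_continuous_on)

lemma test_function_support:
  assumes "test_function \<psi>"
  obtains r where "r > 0" "\<And>x. \<bar>x\<bar> \<ge> r \<Longrightarrow> \<psi> x = 0" "\<And>x. \<bar>x\<bar> \<ge> r \<Longrightarrow> deriv \<psi> x = 0"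
proof -
  have "bounded {x. \<psi> x \<noteq> 0}"
    using assms by (simp add: test_function_def)
  then obtain s where s: "\<And>x. \<psi> x \<noteq> 0 \<Longrightarrow> \<bar>x\<bar> \<le> s"
    by (auto simp: bounded_iff)
  have z: "\<psi> x = 0" if "\<bar>x\<bar> > s" for x using s[of x] that by auto
  have "deriv \<psi> x = 0" if "\<bar>x\<bar> \<ge> \<bar>s\<bar> + 1" for x
  proof (rule DERIV_imp_deriv)
    have "((\<lambda>x. 0) has_real_derivative 0) (at x)" by simp
    then show "(\<psi> has_real_derivative 0) (at x)"
    proof (rule DERIV_cong_ev[THEN iffD1, rotated -1, OF _ refl _ refl])
      have "open {x::real. \<bar>x\<bar> > s}"
        by (intro open_Collect_less continuous_intros)
      then show "\<forall>\<^sub>F x in nhds x. 0 = \<psi> x"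
        using that z by (auto simp: eventually_nhds intro!: exI[of _ "{x. \<bar>x\<bar> > s}"])
    qed
  qed
  then show thesis
    by (intro that[of "\<bar>s\<bar> + 1"]) (auto intro!: z)
qed

lemma locally_integrable_mult_continuous:
  fixes g h :: "real \<Rightarrow> real"
  assumes "locally_integrable g" "continuous_on UNIV h" "\<And>x. \<bar>x\<bar> \<ge> r \<Longrightarrow> h x = 0"
  shows "integrable lborel (\<lambda>x. h x * g x)"
proof -
  have int: "integrable lborel (\<lambda>x. indicator {-r..r} x * g x)"
    using assms(1) by (simp add: locally_integrable_def set_integrable_def)
  have [measurable]: "h \<in> borel_measurable lborel"
    using assms(2) by (simp add: borel_measurable_continuous_onI)
  have "compact (h ` {-r..r})"
    using assms(2) by (intro compact_continuous_image) (auto intro: continuous_on_subset)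
  then obtain M where M: "\<And>x. x \<in> {-r..r} \<Longrightarrow> \<bar>h x\<bar> \<le> M"
    by (force dest!: compact_imp_bounded simp: bounded_iff)
  have "integrable lborel (\<lambda>x. h x * (indicator {-r..r} x * g x))"
  proof (rule Bochner_Integration.integrable_bound)
    show "integrable lborel (\<lambda>x. M * (indicator {-r..r} x * g x))"
      using int by simp
    show "(\<lambda>x. h x * (indicator {-r..r} x * g x)) \<in> borel_measurable lborel"
      using int by measurable
    show "AE x in lborel. norm (h x * (indicator {-r..r} x * g x))
        \<le> norm (M * (indicator {-r..r} x * g x))"
    proof (intro AE_I2)
      fix x
      have "\<bar>h x\<bar> \<le> \<bar>M\<bar>" if "x \<in> {-r..r}" using M[OF that] by linarith
      then show "norm (h x * (indicator {-r..r} x * g x)) \<le> norm (M * (indicator {-r..r} x * g x))"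
        by (auto simp: indicator_def abs_mult intro!: mult_right_mono)
    qed
  qed
  moreover have "h x * (indicator {-r..r} x * g x) = h x * g x" for x
    using assms(3)[of x] by (cases "x \<in> {-r..r}") auto
  ultimately show ?thesis by simp
qed

text \<open>The Borel sets over which \<open>k\<close> integrates to zero form a Dynkin system; it contains the closed
  intervals, hence all Borel sets.\<close>

lemma AE_zero_if_interval_integrals_zero:
  fixes k :: "real \<Rightarrow> real"
  assumes int: "integrable lborel k"
    and total: "(LINT x|lborel. k x) = 0"
    and interval: "\<And>a b. a \<le> b \<Longrightarrow> (LINT x:{a..b}|lborel. k x) = 0"
  shows "AE x in lborel. k x = 0"
proof (rule density_unique_real[OF int])
  have si: "set_integrable lborel A k" if "A \<in> sets borel" for A
    unfolding set_integrable_def by (rule integrable_mult_indicator) (use int that in auto)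
  fix A :: "real set" assume "A \<in> sets lborel"
  then have "A \<in> sets borel" by simp
  then have "(LINT x:A|lborel. k x) = 0"
  proof (induction rule: borel_set_induct)
    case (compl A)
    have "(LINT x:A \<union> (-A)|lborel. k x) = (LINT x:A|lborel. k x) + (LINT x:-A|lborel. k x)"
      by (rule set_integral_Un) (use compl si in auto)
    moreover have "(LINT x:A \<union> (-A)|lborel. k x) = 0"
      using total by (simp add: set_lebesgue_integral_def)
    ultimately show ?case using compl by simp
  next
    case (union f)
    have "(LINT x:(\<Union>i. f i)|lborel. k x) = (\<Sum>i. (LINT x:(f i)|lborel. k x))"
      by (rule lebesgue_integral_countable_add)
         (use union si in \<open>auto simp: disjoint_family_on_def\<close>)
    then show ?case using union by simp
  qed (use interval in \<open>simp_all add: set_lebesgue_integral_def\<close>)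
  then show "(LINT x:A|lborel. k x) = (LINT x:A|lborel. 0)" by simp
qed simp

text \<open>Test functions converging boundedly to the indicator of an interval show that \<open>g\<close> integrates
  to zero over every bounded interval. As \<open>g\<close> need not be integrable over the line, the conclusion is
  drawn on each \<open>{-N..N}\<close> separately.\<close>

lemma fundamental_lemma_calculus_of_variations:
  fixes g :: "real \<Rightarrow> real"
  assumes loc: "locally_integrable g"
    and zero: "\<And>\<psi>. test_function \<psi> \<Longrightarrow> (LINT x|lborel. \<psi> x * g x) = 0"
  shows "AE x in lborel. g x = 0"
proof -
  have int: "integrable lborel (\<lambda>x. indicator {a..b} x * g x)" for a b :: real
    using loc by (simp add: locally_integrable_def set_integrable_def)
  have open_zero: "(LINT x|lborel. indicator {a<..<b} x * g x) = 0" for a b :: real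
  proof (rule LIMSEQ_unique)
    show "(\<lambda>n. LINT x|lborel. bump (real (Suc n)) a b x * g x)
        \<longlonglongrightarrow> (LINT x|lborel. indicator {a<..<b} x * g x)"
    proof (rule integral_dominated_convergence)
      show "integrable lborel (\<lambda>x. norm (indicator {a..b} x * g x))"
        using int by (rule integrable_norm)
      have *: "bump (real (Suc n)) a b x * g x = bump (real (Suc n)) a b x * (indicator {a..b} x * g x)"
        for n x
        using bump_eq_0[of "real (Suc n)" x a b] by (cases "x \<in> {a..b}") auto
      have [measurable]: "bump (real (Suc n)) a b \<in> borel_measurable lborel" for n
        using test_function_continuous[OF test_function_bump]
        by (simp add: borel_measurable_continuous_onI)
      show "(\<lambda>x. bump (real (Suc n)) a b x * g x) \<in> borel_measurable lborel" for n
        unfolding * using int by measurable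
      show "AE x in lborel. norm (bump (real (Suc n)) a b x * g x) \<le> norm (indicator {a..b} x * g x)" for n
        unfolding * using bump_bounds[of "real (Suc n)" a b]
        by (auto simp: abs_mult intro!: AE_I2 mult_left_le_one_le)
      have **: "indicator {a<..<b} x * g x = indicator {a<..<b} x * (indicator {a..b} x * g x)" for x
        by (auto simp: indicator_def)
      show "(\<lambda>x. indicator {a<..<b} x * g x) \<in> borel_measurable lborel"
        unfolding ** using int by measurable
      show "AE x in lborel. (\<lambda>n. bump (real (Suc n)) a b x * g x) \<longlonglongrightarrow> indicator {a<..<b} x * g x"
        by (intro AE_I2 tendsto_mult bump_tendsto_indicator tendsto_const)
    qed
    show "(\<lambda>n. LINT x|lborel. bump (real (Suc n)) a b x * g x) \<longlonglongrightarrow> 0"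
      using zero[OF test_function_bump] by simp
  qed
  have closed_zero: "(LINT x|lborel. indicator {a..b} x * g x) = 0" for a b :: real
  proof -
    have "(LINT x|lborel. indicator {a..b} x * g x) = (LINT x|lborel. indicator {a<..<b} x * g x)"
    proof (rule integral_cong_AE)
      show "(\<lambda>x. indicator {a..b} x * g x) \<in> borel_measurable lborel"
        using int by measurable
      have **: "indicator {a<..<b} x * g x = indicator {a<..<b} x * (indicator {a..b} x * g x)" for x
        by (auto simp: indicator_def)
      show "(\<lambda>x. indicator {a<..<b} x * g x) \<in> borel_measurable lborel"
        unfolding ** using int by measurable
      show "AE x in lborel. indicator {a..b} x * g x = indicator {a<..<b} x * g x"
        using AE_lborel_singleton[of a] AE_lborel_singleton[of b]
        by eventually_elim (auto simp: indicator_def)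
    qed
    with open_zero show ?thesis by simp
  qed
  have "AE x in lborel. indicator {-real N..real N} x * g x = 0" for N :: nat
  proof (rule AE_zero_if_interval_integrals_zero[OF int closed_zero])
    fix a b :: real assume "a \<le> b"
    \<comment> \<open>The truncated function integrates over \<open>{a..b}\<close> as \<open>g\<close> does over a smaller closed interval.\<close>
    have "indicator {a..b} x * (indicator {- real N..real N} x * g x)
        = indicator {max a (- real N)..min b (real N)} x * g x" for x
      by (auto simp: indicator_def)
    then show "(LINT x:{a..b}|lborel. indicator {- real N..real N} x * g x) = 0"
      unfolding set_lebesgue_integral_def real_scaleR_def using closed_zero by presburger
  qed
  then have "AE x in lborel. \<forall>N. indicator {-real N..real N} x * g x = 0"
    unfolding AE_all_countable by blast
  then show ?thesis
  proof eventually_elim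
    case (elim x)
    obtain N where "\<bar>x\<bar> \<le> real N" using real_arch_simple by blast
    then show ?case using elim[rule_format, of N] by (auto simp: indicator_def split: if_splits)
  qed
qed

lemma weak_deriv_unique_AE:
  fixes f g h :: "real \<Rightarrow> real"
  assumes "has_weak_deriv f g" "has_weak_deriv f h"
  shows "AE x in lborel. g x = h x"
proof -
  have loc: "locally_integrable g" "locally_integrable h"
    using assms by (simp_all add: has_weak_deriv_def)
  have "AE x in lborel. g x - h x = 0"
  proof (rule fundamental_lemma_calculus_of_variations)
    show "locally_integrable (\<lambda>x. g x - h x)"
      using loc by (simp add: locally_integrable_def)
    fix \<psi> assume \<psi>: "test_function \<psi>"
    obtain r where r: "\<And>x. \<bar>x\<bar> \<ge> r \<Longrightarrow> \<psi> x = 0"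
      using test_function_support[OF \<psi>] by blast
    have "(LINT x|lborel. \<psi> x * g x) = (LINT x|lborel. \<psi> x * h x)"
      using assms \<psi> by (auto simp: has_weak_deriv_def)
    moreover have "(LINT x|lborel. \<psi> x * (g x - h x))
        = (LINT x|lborel. \<psi> x * g x) - (LINT x|lborel. \<psi> x * h x)"
      using loc[THEN locally_integrable_mult_continuous, OF test_function_continuous[OF \<psi>] r]
      by (simp add: right_diff_distrib)
    ultimately show "(LINT x|lborel. \<psi> x * (g x - h x)) = 0" by simp
  qed
  then show ?thesis by simp
qed

section \<open>Piecewise differentiable functions in the Sobolev space\<close>

lemma locally_integrable_continuous:
  fixes f :: "real \<Rightarrow> real"
  assumes "continuous_on UNIV f"
  shows "locally_integrable f"
  unfolding locally_integrable_def set_integrable_def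
  using assms by (blast intro: borel_integrable_compact continuous_on_subset)

lemma locally_integrable_bounded:
  fixes g :: "real \<Rightarrow> real"
  assumes [measurable]: "g \<in> borel_measurable borel" and "\<And>x. \<bar>g x\<bar> \<le> M"
  shows "locally_integrable g"
  unfolding locally_integrable_def set_integrable_def
proof (intro allI impI)
  fix K :: "real set" assume K: "compact K"
  then have [measurable]: "K \<in> sets borel" by (simp add: borel_compact)
  show "integrable lborel (\<lambda>x. indicator K x *\<^sub>R g x)"
  proof (rule Bochner_Integration.integrable_bound)
    show "integrable lborel (\<lambda>x. indicator K x *\<^sub>R M)"
      using K by (intro borel_integrable_compact continuous_intros)
    show "AE x in lborel. norm (indicator K x *\<^sub>R g x) \<le> norm (indicator K x *\<^sub>R M)"
      using assms(2) by (auto simp: indicator_def intro!: AE_I2 order_trans[OF _ abs_ge_self])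
  qed measurable
qed

text \<open>Integration by parts: \<open>\<psi> f\<close> is continuous, vanishes outside a bounded interval and has derivative
  \<open>deriv \<psi> x * f x + \<psi> x * g x\<close> off a finite set, so this function integrates to zero. Continuity of
  \<open>f\<close> rules out jump terms at the exceptional points.\<close>

lemma has_weak_deriv_if_piecewise_DERIV:
  fixes f g :: "real \<Rightarrow> real"
  assumes "finite S" and cont: "continuous_on UNIV f"
    and deriv: "\<And>x. x \<notin> S \<Longrightarrow> (f has_real_derivative g x) (at x)"
    and g: "locally_integrable g"
  shows "has_weak_deriv f g"
  unfolding has_weak_deriv_def
proof (intro conjI allI impI)
  show f: "locally_integrable f" using cont by (rule locally_integrable_continuous)
  show "locally_integrable g" by fact
  fix \<psi> assume \<psi>: "test_function \<psi>"
  obtain r where r: "r > 0" "\<And>x. \<bar>x\<bar> \<ge> r \<Longrightarrow> \<psi> x = 0" "\<And>x. \<bar>x\<bar> \<ge> r \<Longrightarrow> deriv \<psi> x = 0"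
    using test_function_support[OF \<psi>] by blast
  have int: "integrable lborel (\<lambda>x. deriv \<psi> x * f x)" "integrable lborel (\<lambda>x. \<psi> x * g x)"
    using locally_integrable_mult_continuous[OF f test_function_continuous_deriv[OF \<psi>] r(3)]
      locally_integrable_mult_continuous[OF g test_function_continuous[OF \<psi>] r(2)] by auto
  let ?h = "\<lambda>x. deriv \<psi> x * f x + \<psi> x * g x"
  have "(?h has_integral (\<psi> r * f r - \<psi> (-r) * f (-r))) {-r..r}"
  proof (rule fundamental_theorem_of_calculus_interior_strong[OF \<open>finite S\<close>])
    show "((\<lambda>x. \<psi> x * f x) has_vector_derivative ?h x) (at x)" if "x \<in> {-r<..<r} - S" for x
      using DERIV_mult[OF test_function_DERIV[OF \<psi>] deriv, of x] that
      by (simp add: has_real_derivative_iff_has_vector_derivative algebra_simps)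
    show "continuous_on {-r..r} (\<lambda>x. \<psi> x * f x)"
      using test_function_continuous[OF \<psi>] cont
      by (intro continuous_on_mult) (auto intro: continuous_on_subset)
  qed (use r in auto)
  then have "(?h has_integral 0) {-r..r}" using r by simp
  then have "(?h has_integral 0) UNIV"
    by (rule has_integral_on_superset) (use r(2,3) in \<open>force simp: abs_if\<close>)+
  moreover have "(?h has_integral (LINT x|lborel. ?h x)) UNIV"
    using int by (intro has_integral_integral_lborel) auto
  ultimately have "(LINT x|lborel. ?h x) = 0"
    using has_integral_unique by blast
  then show "(LINT x|lborel. deriv \<psi> x *\<^sub>R f x) = - (LINT x|lborel. \<psi> x *\<^sub>R g x)"
    using int by simp
qed

text \<open>The norm is defined through a chosen weak derivative; almost everywhere uniqueness lets any other
  square-integrable one replace it.\<close>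

lemma H1_norm_eq:
  fixes f g :: "real \<Rightarrow> real"
  assumes "g \<in> L2" "has_weak_deriv f g"
  shows "H1_norm f = sqrt ((LINT x|lborel. (f x)\<^sup>2) + (LINT x|lborel. (g x)\<^sup>2))"
proof -
  have wd: "weak_deriv f \<in> L2 \<and> has_weak_deriv f (weak_deriv f)"
    unfolding weak_deriv_def by (rule someI[of _ g]) (use assms in simp)
  have "(LINT x|lborel. (weak_deriv f x)\<^sup>2) = (LINT x|lborel. (g x)\<^sup>2)"
  proof (rule integral_cong_AE)
    show "AE x in lborel. (weak_deriv f x)\<^sup>2 = (g x)\<^sup>2"
      using weak_deriv_unique_AE[of f "weak_deriv f" g] wd assms by auto
  qed (use wd assms in \<open>auto simp: L2_def\<close>)
  then show ?thesis by (simp add: H1_norm_def)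
qed

section \<open>Cusped sech profiles\<close>

lemma sech_pos: "sech x > 0"
  by (simp add: sech_def)

lemma sech_le_sech:
  assumes "\<bar>x\<bar> \<le> \<bar>y\<bar>"
  shows "sech y \<le> sech x"
proof -
  have "cosh x \<le> cosh y"
    using assms cosh_real_nonneg_le_iff[of "\<bar>x\<bar>" "\<bar>y\<bar>"] by simp
  then show ?thesis by (simp add: sech_def frac_le)
qed

lemma continuous_on_sech [continuous_intros]:
  "continuous_on S f \<Longrightarrow> continuous_on S (\<lambda>x. sech (f x))"
  unfolding sech_def by (intro continuous_intros) auto

lemma tendsto_sech [tendsto_intros]:
  "(f \<longlongrightarrow> y) F \<Longrightarrow> ((\<lambda>x. sech (f x)) \<longlongrightarrow> sech y) F"
  unfolding sech_def by (intro tendsto_intros) auto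

lemma DERIV_sech: "(sech has_real_derivative - tanh x * sech x) (at x)"
  unfolding sech_def[abs_def]
  by (auto intro!: derivative_eq_intros simp: tanh_def power2_eq_square)

lemma integrable_sech_square:
  assumes "b > 0"
  shows "integrable lborel (\<lambda>x. (sech (b * x))\<^sup>2)"
proof -
  have "set_integrable lborel (einterval (-\<infinity>) \<infinity>) (\<lambda>x. (sech x)\<^sup>2)"
  proof (rule interval_integral_FTC_nonneg(1))
    show "(tanh has_real_derivative (sech x)\<^sup>2) (at x)" for x :: real
    proof -
      have "1 - (tanh x)\<^sup>2 = ((cosh x)\<^sup>2 - (sinh x)\<^sup>2) / (cosh x)\<^sup>2"
        by (simp add: tanh_def power_divide diff_divide_distrib)
      then have "1 - (tanh x)\<^sup>2 = (sech x)\<^sup>2"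
        by (simp add: hyperbolic_pythagoras sech_def power_divide)
      then show ?thesis by (auto intro!: derivative_eq_intros)
    qed
    show "isCont (\<lambda>x. (sech x)\<^sup>2) x" for x
      by (rule continuous_on_interior[of UNIV]) (auto intro!: continuous_intros)
    show "((tanh \<circ> real_of_ereal) \<longlongrightarrow> (-1::real)) (at_right (-\<infinity>))"
      using tanh_real_at_bot by (simp add: ereal_tendsto_simps)
    show "((tanh \<circ> real_of_ereal) \<longlongrightarrow> (1::real)) (at_left \<infinity>)"
      using tanh_real_at_top by (simp add: ereal_tendsto_simps)
  qed auto
  then have "integrable lborel (\<lambda>x::real. (sech x)\<^sup>2)"
    by (simp add: set_integrable_def)
  from lborel_integrable_real_affine[OF this, of b 0] show ?thesis
    using assms by simp
qed

definition sech_cusp :: "real \<Rightarrow> real \<Rightarrow> real \<Rightarrow> real \<Rightarrow> real" where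
  "sech_cusp A B s x = A * sech (B * (\<bar>x\<bar> - s))"

text \<open>The classical derivative of the cusped profile away from the cusp; \<open>sgn 0 = 0\<close> gives it the
  value zero there.\<close>

definition sech_cusp_deriv :: "real \<Rightarrow> real \<Rightarrow> real \<Rightarrow> real \<Rightarrow> real" where
  "sech_cusp_deriv A B s x = - (A * B * sgn x * tanh (B * (\<bar>x\<bar> - s)) * sech (B * (\<bar>x\<bar> - s)))"

lemma continuous_on_sech_cusp: "continuous_on S (sech_cusp A B s)"
  unfolding sech_cusp_def by (intro continuous_intros)

lemma borel_measurable_sech_cusp [measurable]: "sech_cusp A B s \<in> borel_measurable borel"
  by (intro borel_measurable_continuous_onI continuous_on_sech_cusp)

lemma borel_measurable_sech_cusp_deriv [measurable]:
  "sech_cusp_deriv A B s \<in> borel_measurable borel"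
proof -
  have [measurable]: "(\<lambda>x. tanh (B * (\<bar>x\<bar> - s))) \<in> borel_measurable borel"
    "(\<lambda>x. sech (B * (\<bar>x\<bar> - s))) \<in> borel_measurable borel"
    by (intro borel_measurable_continuous_onI continuous_intros; simp)+
  have "(sgn :: real \<Rightarrow> real) \<in> borel_measurable borel"
    by measurable
  then show ?thesis unfolding sech_cusp_deriv_def by measurable
qed

lemma DERIV_sech_cusp:
  assumes "x \<noteq> 0"
  shows "(sech_cusp A B s has_real_derivative sech_cusp_deriv A B s x) (at x)"
proof -
  have "((\<lambda>x. \<bar>x\<bar>) has_real_derivative sgn x) (at x)"
  proof (cases "x > 0")
    case True
    have "((\<lambda>x. x) has_real_derivative 1) (at x)" by (auto intro!: derivative_eq_intros)
    then show ?thesis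
      using True has_field_derivative_transform_within_open[of "\<lambda>x. x" 1 x "{0<..}" abs] by simp
  next
    case False
    have "(uminus has_real_derivative -1) (at x)" by (auto intro!: derivative_eq_intros)
    then show ?thesis
      using False assms has_field_derivative_transform_within_open[of uminus "-1" x "{..<0}" abs]
      by simp
  qed
  then have "((\<lambda>x. B * (\<bar>x\<bar> - s)) has_real_derivative B * sgn x) (at x)"
    by (auto intro!: derivative_eq_intros)
  from DERIV_cmult[OF DERIV_chain2[OF DERIV_sech this], of A] show ?thesis
    unfolding sech_cusp_def sech_cusp_deriv_def by (simp add: algebra_simps)
qed

text \<open>Moving the centre of the profile to the left of the cusp (\<open>s \<le> 0\<close>) and steepening it only enlarge
  the argument of \<open>sech\<close>, so the bound is uniform in \<open>s\<close> and, up to its constant, in \<open>B \<ge> b\<close>.\<close>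

lemma sech_cusp_bound:
  assumes "0 < b" "b \<le> B" "s \<le> 0"
  shows "\<bar>sech_cusp A B s x\<bar> \<le> \<bar>A\<bar> * sech (b * x)"
    and "\<bar>sech_cusp_deriv A B s x\<bar> \<le> \<bar>A * B\<bar> * sech (b * x)"
proof -
  have "\<bar>b * x\<bar> \<le> \<bar>B * (\<bar>x\<bar> - s)\<bar>"
    unfolding abs_mult using assms by (intro mult_mono) auto
  then have *: "sech (B * (\<bar>x\<bar> - s)) \<le> sech (b * x)"
    by (rule sech_le_sech)
  then show "\<bar>sech_cusp A B s x\<bar> \<le> \<bar>A\<bar> * sech (b * x)"
    using sech_pos[of "B * (\<bar>x\<bar> - s)"] by (simp add: sech_cusp_def abs_mult mult_left_mono)
  have "\<bar>sgn x * tanh (B * (\<bar>x\<bar> - s))\<bar> \<le> 1"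
    using tanh_real_bounds[of "B * (\<bar>x\<bar> - s)"] by (auto simp: abs_mult sgn_if)
  then have "\<bar>sgn x * tanh (B * (\<bar>x\<bar> - s))\<bar> * \<bar>sech (B * (\<bar>x\<bar> - s))\<bar> \<le> 1 * sech (b * x)"
    using * sech_pos[of "B * (\<bar>x\<bar> - s)"] by (intro mult_mono) auto
  then have "\<bar>A * B\<bar> * (\<bar>sgn x * tanh (B * (\<bar>x\<bar> - s))\<bar> * \<bar>sech (B * (\<bar>x\<bar> - s))\<bar>)
      \<le> \<bar>A * B\<bar> * sech (b * x)"
    by (intro mult_left_mono) auto
  then show "\<bar>sech_cusp_deriv A B s x\<bar> \<le> \<bar>A * B\<bar> * sech (b * x)"
    by (simp add: sech_cusp_deriv_def abs_mult mult.assoc)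
qed

lemma L2_if_sech_bound:
  fixes f :: "real \<Rightarrow> real"
  assumes [measurable]: "f \<in> borel_measurable borel"
    and "b > 0" "\<And>x. \<bar>f x\<bar> \<le> K * sech (b * x)"
  shows "f \<in> L2"
proof -
  have "integrable lborel (\<lambda>x. (f x)\<^sup>2)"
  proof (rule Bochner_Integration.integrable_bound)
    show "integrable lborel (\<lambda>x. K\<^sup>2 * (sech (b * x))\<^sup>2)"
      using integrable_sech_square[OF \<open>b > 0\<close>] by simp
    show "AE x in lborel. norm ((f x)\<^sup>2) \<le> norm (K\<^sup>2 * (sech (b * x))\<^sup>2)"
      using power_mono[OF assms(3) abs_ge_zero, of _ 2] by (auto simp: power_mult_distrib)
  qed measurable
  then show ?thesis by (simp add: L2_def)
qed

lemma sech_cusp_H1: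
  assumes "0 < B" "s \<le> 0"
  shows "sech_cusp A B s \<in> H1"
proof -
  note bound = sech_cusp_bound[OF assms(1) order_refl assms(2)]
  have "\<bar>sech_cusp_deriv A B s x\<bar> \<le> \<bar>A * B\<bar>" for x
    using order_trans[OF bound(2) mult_left_mono[of _ 1]] sech_le_sech[of 0 "B * x"]
    by (simp add: sech_def)
  then have "locally_integrable (sech_cusp_deriv A B s)"
    by (intro locally_integrable_bounded) auto
  then have "has_weak_deriv (sech_cusp A B s) (sech_cusp_deriv A B s)"
    by (intro has_weak_deriv_if_piecewise_DERIV[of "{0}"] continuous_on_sech_cusp DERIV_sech_cusp)
       auto
  moreover have "sech_cusp A B s \<in> L2" "sech_cusp_deriv A B s \<in> L2"
    by (rule L2_if_sech_bound[OF _ assms(1) bound(1)] L2_if_sech_bound[OF _ assms(1) bound(2)],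
        measurable)+
  ultimately show ?thesis by (auto simp: H1_def)
qed

text \<open>The form of dominated convergence used for the profiles as well as for their derivatives.\<close>

lemma integral_square_diff_tendsto_0:
  fixes f :: "nat \<Rightarrow> real \<Rightarrow> real"
  assumes [measurable]: "\<And>n. f n \<in> borel_measurable borel" "g \<in> borel_measurable borel"
    and b: "b > 0"
    and f: "\<And>n x. \<bar>f n x\<bar> \<le> K * sech (b * x)"
    and lim: "\<And>x. (\<lambda>n. f n x) \<longlonglongrightarrow> g x"
  shows "(\<lambda>n. LINT x|lborel. (f n x - g x)\<^sup>2) \<longlonglongrightarrow> 0"
proof -
  have "(\<lambda>n. LINT x|lborel. (f n x - g x)\<^sup>2) \<longlonglongrightarrow> (LINT x|(lborel :: real measure). 0)"
  proof (rule integral_dominated_convergence)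
    show "integrable lborel (\<lambda>x. (2 * K)\<^sup>2 * (sech (b * x))\<^sup>2)"
      using integrable_sech_square[OF b] by simp
    have g: "\<bar>g x\<bar> \<le> K * sech (b * x)" for x
      using f by (intro LIMSEQ_le_const2[OF tendsto_rabs[OF lim]]) auto
    show "AE x in lborel. norm ((f n x - g x)\<^sup>2) \<le> (2 * K)\<^sup>2 * (sech (b * x))\<^sup>2" for n
    proof (intro AE_I2)
      fix x
      have "\<bar>f n x - g x\<bar> \<le> (2 * K) * sech (b * x)"
        using f[of n x] g[of x] by linarith
      then have "\<bar>f n x - g x\<bar>\<^sup>2 \<le> ((2 * K) * sech (b * x))\<^sup>2"
        by (intro power_mono) auto
      then show "norm ((f n x - g x)\<^sup>2) \<le> (2 * K)\<^sup>2 * (sech (b * x))\<^sup>2"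
        by (simp add: power_mult_distrib)
    qed
    show "AE x in lborel. (\<lambda>n. (f n x - g x)\<^sup>2) \<longlonglongrightarrow> 0"
    proof (intro AE_I2)
      show "(\<lambda>n. (f n x - g x)\<^sup>2) \<longlonglongrightarrow> 0" for x
        using tendsto_power[OF LIM_zero[OF lim[of x]], of 2] by simp
    qed
  qed measurable
  then show ?thesis by simp
qed

lemma sech_cusp_tendsto_H1_norm:
  assumes A: "A \<longlonglongrightarrow> A0" and B: "B \<longlonglongrightarrow> B0" and s: "s \<longlonglongrightarrow> s0"
    and b: "b > 0" "\<And>n. b \<le> B n" and neg: "\<And>n. s n \<le> 0"
  shows "(\<lambda>n. H1_norm (\<lambda>x. sech_cusp (A n) (B n) (s n) x - sech_cusp A0 B0 s0 x)) \<longlonglongrightarrow> 0"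
proof -
  let ?f = "\<lambda>n. sech_cusp (A n) (B n) (s n)" and ?g = "sech_cusp A0 B0 s0"
  let ?f' = "\<lambda>n. sech_cusp_deriv (A n) (B n) (s n)" and ?g' = "sech_cusp_deriv A0 B0 s0"
  obtain K where K: "\<And>n. \<bar>A n\<bar> \<le> K"
    using convergent_imp_Bseq[OF convergentI[OF A]]
    by (auto simp: Bseq_def)
  obtain L where L: "\<And>n. \<bar>A n * B n\<bar> \<le> L"
    using convergent_imp_Bseq[OF convergentI[OF tendsto_mult[OF A B]]] by (auto simp: Bseq_def)
  have f: "\<bar>?f n x\<bar> \<le> K * sech (b * x)" and f': "\<bar>?f' n x\<bar> \<le> L * sech (b * x)" for n x
    using order_trans[OF sech_cusp_bound(1)[OF b neg] mult_right_mono[OF K]]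
      order_trans[OF sech_cusp_bound(2)[OF b neg] mult_right_mono[OF L]]
      sech_pos less_imp_le by blast+
  have lim: "(\<lambda>n. ?f n x) \<longlonglongrightarrow> ?g x" and lim': "(\<lambda>n. ?f' n x) \<longlonglongrightarrow> ?g' x" for x
    unfolding sech_cusp_def sech_cusp_deriv_def by (intro tendsto_intros A B s; simp)+
  have g': "\<bar>?g' x\<bar> \<le> L * sech (b * x)" for x
    using f' by (intro LIMSEQ_le_const2[OF tendsto_rabs[OF lim']]) auto
  \<comment> \<open>The norm of the difference is computed from the difference of the classical derivatives.\<close>
  have d: "\<bar>?f' n x - ?g' x\<bar> \<le> (2 * L) * sech (b * x)" for n x
    using f'[of n x] g'[of x] by linarith
  have L0: "L \<ge> 0" using L[of 0] by linarith
  have "\<bar>?f' n x - ?g' x\<bar> \<le> 2 * L" for n x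
    using order_trans[OF d mult_left_mono[of _ 1]] sech_le_sech[of 0 "b * x"] L0
    by (simp add: sech_def)
  then have "locally_integrable (\<lambda>x. ?f' n x - ?g' x)" for n
    by (intro locally_integrable_bounded) auto
  then have wd: "has_weak_deriv (\<lambda>x. ?f n x - ?g x) (\<lambda>x. ?f' n x - ?g' x)" for n
    by (intro has_weak_deriv_if_piecewise_DERIV[of "{0}"] continuous_on_diff
          continuous_on_sech_cusp DERIV_diff DERIV_sech_cusp) auto
  have L2: "(\<lambda>x. ?f' n x - ?g' x) \<in> L2" for n
    by (rule L2_if_sech_bound[OF _ b(1) d]) measurable
  have "(\<lambda>n. sqrt ((LINT x|lborel. (?f n x - ?g x)\<^sup>2) + (LINT x|lborel. (?f' n x - ?g' x)\<^sup>2)))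
      \<longlonglongrightarrow> sqrt (0 + 0)"
    using f f' lim lim' b(1)
    by (intro tendsto_intros integral_square_diff_tendsto_0) auto
  then show ?thesis
    by (simp add: H1_norm_eq[OF L2 wd])
qed

section \<open>The limit of vanishing delta potential\<close>

text \<open>The logarithm is taken of a number below one: an attractive delta potential removes a
  neighbourhood of the soliton peak and leaves a cusp.\<close>

lemma delta_shift_nonpos:
  assumes "lam > 0" "\<rho> > 0" "\<alpha> > 0"
  shows "delta_shift \<alpha> \<rho> lam \<le> 0"
  using assms unfolding delta_shift_def
  by (intro mult_nonneg_nonpos ln_le_zero_iff[THEN iffD2]) (auto simp: add_pos_pos divide_simps)

lemma delta_shift_tendsto_0:
  assumes "lam > 0" "\<rho> > 0"
  shows "((\<lambda>\<alpha>. delta_shift \<alpha> \<rho> lam) \<longlongrightarrow> 0) (at 0)"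
proof -
  have "((\<lambda>\<alpha>. delta_shift \<alpha> \<rho> lam) \<longlongrightarrow>
      2 / (lam * \<rho> + 2 * 0) * ln (lam * \<rho> / (lam * \<rho> + 4 * 0))) (at 0)"
    unfolding delta_shift_def using assms by (intro tendsto_intros) auto
  then show ?thesis using assms by simp
qed

theorem theorem2p3:
  fixes lam \<rho> :: real
  assumes "lam > 0" and "\<rho> > 0"
  shows "tendsto_H1 (\<lambda>\<alpha>. delta_ground_state \<alpha> \<rho> lam)
           (soliton (sqrt lam * \<rho> / (2 * sqrt 2)) (lam * \<rho> / 4) 0) (at_right 0)"
proof -
  define A where "A \<alpha> = sqrt lam * \<rho> / (2 * sqrt 2) + \<alpha> / sqrt (2 * lam)" for \<alpha>
  define B where "B \<alpha> = lam * \<rho> / 4 + \<alpha> / 2" for \<alpha>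
  define s where "s \<alpha> = delta_shift \<alpha> \<rho> lam" for \<alpha>
  have state: "delta_ground_state \<alpha> \<rho> lam = sech_cusp (A \<alpha>) (B \<alpha>) (s \<alpha>)" for \<alpha>
    by (simp add: fun_eq_iff delta_ground_state_def sech_cusp_def A_def B_def s_def)
  have "cosh (lam * \<rho> / 4 * \<bar>x\<bar>) = cosh (lam * \<rho> / 4 * x)" for x
    by (cases "x \<ge> 0") auto
  then have limit: "soliton (sqrt lam * \<rho> / (2 * sqrt 2)) (lam * \<rho> / 4) 0
      = sech_cusp (A 0) (B 0) 0"
    by (simp add: fun_eq_iff soliton_def sech_cusp_def sech_def A_def B_def)
  have pos: "B 0 > 0" and B_ge: "\<alpha> > 0 \<Longrightarrow> B 0 \<le> B \<alpha>" for \<alpha>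
    using assms by (auto simp: B_def)
  have s_neg: "\<alpha> > 0 \<Longrightarrow> s \<alpha> \<le> 0" for \<alpha>
    using delta_shift_nonpos assms by (simp add: s_def)
  have "((\<lambda>\<alpha>. H1_norm (\<lambda>x. sech_cusp (A \<alpha>) (B \<alpha>) (s \<alpha>) x - sech_cusp (A 0) (B 0) 0 x)) \<longlongrightarrow> 0)
      (at_right 0)"
  proof (rule tendsto_at_right_sequentially[of 0 1])
    fix \<alpha> :: "nat \<Rightarrow> real" assume \<alpha>: "\<And>n. 0 < \<alpha> n" "\<alpha> \<longlonglongrightarrow> 0"
    show "(\<lambda>n. H1_norm (\<lambda>x. sech_cusp (A (\<alpha> n)) (B (\<alpha> n)) (s (\<alpha> n)) x - sech_cusp (A 0) (B 0) 0 x))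
        \<longlonglongrightarrow> 0"
    proof (rule sech_cusp_tendsto_H1_norm[where b = "B 0"])
      show "(\<lambda>n. A (\<alpha> n)) \<longlonglongrightarrow> A 0" "(\<lambda>n. B (\<alpha> n)) \<longlonglongrightarrow> B 0"
        unfolding A_def B_def using assms by (intro tendsto_intros \<alpha>; simp)+
      have "filterlim \<alpha> (at 0) sequentially"
        using \<alpha> by (auto simp: filterlim_at less_imp_neq[symmetric])
      then show "(\<lambda>n. s (\<alpha> n)) \<longlonglongrightarrow> 0"
        unfolding s_def by (rule filterlim_compose[OF delta_shift_tendsto_0[OF assms]])
    qed (use \<alpha> pos B_ge s_neg in auto)
  qed simp
  moreover have "eventually (\<lambda>\<alpha>. sech_cusp (A \<alpha>) (B \<alpha>) (s \<alpha>) \<in> H1) (at_right 0)"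
    using eventually_at_right_less[of "0::real"]
    by eventually_elim (use pos B_ge s_neg in \<open>force intro: sech_cusp_H1 less_le_trans\<close>)
  ultimately show ?thesis
    unfolding tendsto_H1_def state limit using sech_cusp_H1[OF pos order_refl] by blast
qed

end
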